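(* If $MA_{\omega_1}$ holds then (1) $[\omega_1,\omega,\omega]\Rightarrow\omega$ and (2) $[\omega_1,\omega_1,\omega]\Rightarrow\omega$.
   Context: $MA_{\omega_1}$ is Martin's Axiom for $\omega_1$ dense sets. For a function $f$ and a set $A$, $I_f(A)=\{\xi\in\operatorname{ran}(f):|A\cap f^{-1}\{\xi\}|=1\}$. A $(\lambda,\kappa,\mu)$-system is a family $\mathcal A$ with $|\mathcal A|=\lambda$, $|A|=\kappa$ for all $A\in\mathcal A$, and $|A\cap A'|<\mu$ for distinct members. For cardinals $\lambda\ge\kappa\ge\rho\ge\omega$ and $\mu\le\kappa$, $[\lambda,\kappa,\mu]\Rightarrow\rho$ means: for every $(\lambda,\kappa,\mu)$-system $\mathcal A$ there is $f:\bigcup\mathcal A\to\rho$ with $|\rho\setminus I_f(A)|<\rho$ for every $A\in\mathcal A$. *)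

theory Defs
  imports Main "HOL-Library.Countable_Set"
begin

abbreviation omega1 :: "nat set rel" where
  "omega1 \<equiv> cardSuc natLeq"

text \<open>Forcing notions: a nonempty set P with a reflexive, transitive relation le
  (le q p means q is stronger than / extends p).\<close>
definition forcing_order :: "'p set \<Rightarrow> ('p \<Rightarrow> 'p \<Rightarrow> bool) \<Rightarrow> bool" where
  "forcing_order P le \<longleftrightarrow> P \<noteq> {} \<and> (\<forall>p\<in>P. le p p) \<and>
     (\<forall>p\<in>P. \<forall>q\<in>P. \<forall>r\<in>P. le p q \<longrightarrow> le q r \<longrightarrow> le p r)"

definition compatible :: "'p set \<Rightarrow> ('p \<Rightarrow> 'p \<Rightarrow> bool) \<Rightarrow> 'p \<Rightarrow> 'p \<Rightarrow> bool" where
  "compatible P le p q \<longleftrightarrow> (\<exists>r\<in>P. le r p \<and> le r q)"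

definition ccc :: "'p set \<Rightarrow> ('p \<Rightarrow> 'p \<Rightarrow> bool) \<Rightarrow> bool" where
  "ccc P le \<longleftrightarrow> (\<forall>X\<subseteq>P. (\<forall>p\<in>X. \<forall>q\<in>X. p \<noteq> q \<longrightarrow> \<not> compatible P le p q) \<longrightarrow> countable X)"

definition dense_in :: "'p set \<Rightarrow> ('p \<Rightarrow> 'p \<Rightarrow> bool) \<Rightarrow> 'p set \<Rightarrow> bool" where
  "dense_in P le D \<longleftrightarrow> D \<subseteq> P \<and> (\<forall>p\<in>P. \<exists>q\<in>D. le q p)"

definition filter_in :: "'p set \<Rightarrow> ('p \<Rightarrow> 'p \<Rightarrow> bool) \<Rightarrow> 'p set \<Rightarrow> bool" where
  "filter_in P le G \<longleftrightarrow> G \<subseteq> P \<and> G \<noteq> {} \<and>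
     (\<forall>p\<in>G. \<forall>q\<in>P. le p q \<longrightarrow> q \<in> G) \<and>
     (\<forall>p\<in>G. \<forall>q\<in>G. \<exists>r\<in>G. le r p \<and> le r q)"

definition MA_omega1 :: "'p itself \<Rightarrow> bool" where
  "MA_omega1 _ \<longleftrightarrow>
    (\<forall>(P::'p set) le (\<D>::'p set set).
       forcing_order P le \<and> ccc P le \<and> (\<forall>D\<in>\<D>. dense_in P le D) \<and>
       (card_of \<D>, omega1) \<in> ordLeq
       \<longrightarrow> (\<exists>G. filter_in P le G \<and> (\<forall>D\<in>\<D>. G \<inter> D \<noteq> {})))"

definition is_system :: "'b set set \<Rightarrow> 'l rel \<Rightarrow> 'k rel \<Rightarrow> 'm rel \<Rightarrow> bool" where
  "is_system \<A> lam kap mu \<longleftrightarrow>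
     (card_of \<A>, lam) \<in> ordIso \<and>
     (\<forall>A\<in>\<A>. (card_of A, kap) \<in> ordIso) \<and>
     (\<forall>A\<in>\<A>. \<forall>A'\<in>\<A>. A \<noteq> A' \<longrightarrow> (card_of (A \<inter> A'), mu) \<in> ordLess)"

definition I_f :: "('b \<Rightarrow> 'c) \<Rightarrow> 'b set \<Rightarrow> 'b set \<Rightarrow> 'c set" where
  "I_f f U A = {\<xi> \<in> f ` U. \<exists>!x. x \<in> A \<and> f x = \<xi>}"

text \<open>[lam,kap,mu] => omega, for systems of subsets of the type 'b; rho = omega is
  represented by nat, and |omega - I_f(A)| < omega means finiteness.\<close>
definition arrow_omega :: "'b itself \<Rightarrow> 'l rel \<Rightarrow> 'k rel \<Rightarrow> 'm rel \<Rightarrow> bool" where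
  "arrow_omega _ lam kap mu \<longleftrightarrow>
     (\<forall>\<A>::'b set set. is_system \<A> lam kap mu \<longrightarrow>
        (\<exists>f::'b \<Rightarrow> nat. \<forall>A\<in>\<A>. finite (UNIV - I_f f (\<Union>\<A>) A)))"

end

theory Submission
  imports Defs "HOL-Library.Countable_Set_Type"
begin

text \<open>For countable members, force with finite partial colourings of the points together with
  finitely many promises about members. Suppose there were an uncountable antichain, and thin it
  out to conditions sharing a root. Choose conditions \<open>p n\<close> (\<open>n < \<omega>\<close>), and then conditions \<open>q i\<close>
  none of whose new points lie in a member promised by some \<open>p n\<close>. Incompatibility makes some
  new member of every \<open>q i\<close> meet the new points of every \<open>p n\<close>, and by the pigeonhole principle
  two such members meet infinitely often, contradicting almost disjointness.

  Uncountable members are reduced to this case by a set of points that meets every member in a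
  countably infinite set; all other points receive colour 0.\<close>

unbundle cardinal_syntax

section \<open>Cardinal arithmetic at the first uncountable cardinal\<close>

lemma Cinfinite_omega1: "Cinfinite omega1"
  by (rule Cinfinite_cardSuc[OF natLeq_Cinfinite])

lemma Field_omega1: "\<not> finite (Field omega1)"
  using Cinfinite_omega1 by (simp add: cinfinite_def)

lemma countable_imp_ordLeq_omega1: "countable A \<Longrightarrow> |A| \<le>o omega1"
  using countable_card_le_natLeq cardSuc_ordLeq[OF natLeq_Card_order] ordLeq_transitive by blast

lemma ordLess_omega1_iff: "|A| <o omega1 \<longleftrightarrow> countable A"
  using cardSuc_ordLeq_ordLess[OF natLeq_Card_order card_of_Card_order] countable_card_le_natLeq
  by blast

lemma uncountable_imp_omega1_ordLeq: "\<not> countable A \<Longrightarrow> omega1 \<le>o |A|"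
  using ordLess_omega1_iff[of A] Cinfinite_omega1 card_of_Well_order
  by (metis card_order_on_well_order_on not_ordLess_iff_ordLeq)

text \<open>Every set of size \<open>Suc n\<close> is \<open>insert x p\<close> with
  \<open>p\<close> of size \<open>n\<close>, so induction on the size bounds each level by a
  product; the countably many levels are then united.\<close>

lemma card_of_finite_subsets:
  assumes r: "Cinfinite r" and S: "|S| \<le>o r"
  shows "|{p. finite p \<and> p \<subseteq> S}| \<le>o r"
proof -
  have inf: "\<not> finite (Field r)" and co: "Card_order r"
    using r by (auto simp: cinfinite_def)
  have fin_n: "|{p. finite p \<and> p \<subseteq> S \<and> card p = n}| \<le>o r" for n
  proof (induction n)
    case 0
    have "{p. finite p \<and> p \<subseteq> S \<and> card p = 0} = {{}}" by auto
    moreover have "|{{}}| \<le>o r"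
      using inf co by (metis Card_order_singl_ordLeq finite.emptyI)
    ultimately show ?case by simp
  next
    case (Suc n)
    let ?T = "{p. finite p \<and> p \<subseteq> S \<and> card p = n}"
    have "{p. finite p \<and> p \<subseteq> S \<and> card p = Suc n} \<subseteq> (\<lambda>(x, p). insert x p) ` (S \<times> ?T)"
    proof
      fix p assume "p \<in> {p. finite p \<and> p \<subseteq> S \<and> card p = Suc n}"
      then have p: "finite p" "p \<subseteq> S" "card p = Suc n" by auto
      then obtain x where x: "x \<in> p" by fastforce
      then have "(x, p - {x}) \<in> S \<times> ?T" "p = insert x (p - {x})" using p by auto
      then show "p \<in> (\<lambda>(x, p). insert x p) ` (S \<times> ?T)" by (metis (mono_tags) case_prod_conv imageI)
    qed
    moreover have "|(\<lambda>(x, p). insert x p) ` (S \<times> ?T)| \<le>o r"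
      by (rule ordLeq_transitive[OF card_of_image
            card_of_Times_ordLeq_infinite_Field[OF inf S Suc.IH co]])
    ultimately show ?case by (rule ordLeq_transitive[OF card_of_mono1])
  qed
  have "|UNIV :: nat set| \<le>o r"
    using infinite_iff_card_of_nat inf card_of_Field_ordIso[OF co] ordLeq_ordIso_trans by blast
  then have "|\<Union>n. {p. finite p \<and> p \<subseteq> S \<and> card p = n}| \<le>o r"
    by (rule UNION_Cinfinite_bound[OF _ _ r]) (simp add: fin_n)
  moreover have "(\<Union>n. {p. finite p \<and> p \<subseteq> S \<and> card p = n}) = {p. finite p \<and> p \<subseteq> S}"
    by auto
  ultimately show ?thesis by simp
qed

section \<open>Transferring Martin's Axiom to another carrier type\<close>

text \<open>The axiom is assumed for orders on \<open>'p\<close> only, while conditions live on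
  another type. An uncountable \<open>'p\<close> has at least \<open>omega1\<close> elements, so
  \<open>Q\<close> embeds into it by \<open>e\<close>. Order and dense sets are carried over along
  \<open>e\<close>, and the filter is pulled back along its inverse \<open>g\<close>.\<close>

lemma MA_omega1_transfer:
  fixes Q :: "'q set"
  assumes MA: "MA_omega1 TYPE('p)" and unc: "\<not> countable (UNIV :: 'p set)"
    and Q: "forcing_order Q le" "ccc Q le" "|Q| \<le>o omega1"
    and D: "\<And>D. D \<in> \<D> \<Longrightarrow> dense_in Q le D" "|\<D>| \<le>o omega1"
  shows "\<exists>G. filter_in Q le G \<and> (\<forall>D\<in>\<D>. G \<inter> D \<noteq> {})"
proof -
  have "|Q| \<le>o |UNIV :: 'p set|"
    using Q(3) uncountable_imp_omega1_ordLeq[OF unc] ordLeq_transitive by blast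
  then obtain e :: "'q \<Rightarrow> 'p" where e: "inj_on e Q"
    by (metis card_of_ordLeq)
  define P where "P = e ` Q"
  define g where "g = inv_into Q e"
  have ge: "g (e q) = q" if "q \<in> Q" for q using e that by (simp add: g_def)
  have gP: "g p \<in> Q" "e (g p) = p" if "p \<in> P" for p
    using that ge unfolding P_def by auto
  define le' where "le' = (\<lambda>p q. le (g p) (g q))"
  have fo: "forcing_order P le'"
    unfolding forcing_order_def le'_def
  proof (intro conjI ballI impI)
    show "P \<noteq> {}" using Q(1) unfolding forcing_order_def P_def by blast
  next
    fix p assume "p \<in> P"
    then show "le (g p) (g p)" using Q(1) gP(1) unfolding forcing_order_def by blast
  next
    fix p q r assume "p \<in> P" "q \<in> P" "r \<in> P"
    then have "g p \<in> Q" "g q \<in> Q" "g r \<in> Q" by (simp_all add: gP(1))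
    moreover assume "le (g p) (g q)" "le (g q) (g r)"
    ultimately show "le (g p) (g r)" using Q(1) unfolding forcing_order_def by blast
  qed
  have "ccc P le'"
    unfolding ccc_def
  proof (intro allI impI)
    fix X assume X: "X \<subseteq> P" "\<forall>p\<in>X. \<forall>q\<in>X. p \<noteq> q \<longrightarrow> \<not> compatible P le' p q"
    have "g ` X \<subseteq> Q" using X(1) gP by auto
    moreover have "\<not> compatible Q le p q" if pq: "p \<in> g ` X" "q \<in> g ` X" "p \<noteq> q" for p q
    proof
      assume "compatible Q le p q"
      then obtain r where r: "r \<in> Q" "le r p" "le r q" unfolding compatible_def by blast
      obtain a b where ab: "a \<in> X" "b \<in> X" "p = g a" "q = g b" using pq by blast
      have "compatible P le' a b"
        unfolding compatible_def le'_def
        by (rule bexI[of _ "e r"]) (use r ab in \<open>auto simp: ge P_def\<close>)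
      moreover have "a \<noteq> b" using ab pq(3) by auto
      ultimately show False using X(2) ab(1,2) by metis
    qed
    ultimately have "countable (g ` X)"
      using Q(2)[unfolded ccc_def, rule_format, of "g ` X"] by metis
    then have "countable (e ` g ` X)" by (rule countable_image)
    moreover have "e ` g ` X = X" using X(1) gP(2) by (force simp: image_image)
    ultimately show "countable X" by simp
  qed
  moreover have "\<forall>D\<in>(`) e ` \<D>. dense_in P le' D"
  proof
    fix D' assume "D' \<in> (`) e ` \<D>"
    then obtain D where D': "D \<in> \<D>" "D' = e ` D" by blast
    have DQ: "D \<subseteq> Q" and dn: "\<And>p. p \<in> Q \<Longrightarrow> \<exists>q\<in>D. le q p"
      using D(1)[OF D'(1)] unfolding dense_in_def by auto
    have "\<exists>q\<in>D'. le' q p" if "p \<in> P" for p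
      using dn[OF gP(1)[OF that]] DQ ge D'(2) unfolding le'_def by force
    then show "dense_in P le' D'" unfolding dense_in_def using DQ D'(2) P_def by auto
  qed
  moreover have "|(`) e ` \<D>| \<le>o omega1"
    using card_of_image D(2) ordLeq_transitive by blast
  ultimately obtain G where G: "filter_in P le' G" "\<And>D. D \<in> \<D> \<Longrightarrow> G \<inter> e ` D \<noteq> {}"
    using MA fo unfolding MA_omega1_def by (metis imageI)
  have GP: "G \<subseteq> P" using G(1) unfolding filter_in_def by blast
  have "filter_in Q le (g ` G)"
    unfolding filter_in_def
  proof (intro conjI ballI impI)
    show "g ` G \<subseteq> Q" using GP gP by auto
    show "g ` G \<noteq> {}" using G(1) unfolding filter_in_def by blast
  next
    fix p q assume pq: "p \<in> g ` G" "q \<in> Q" "le p q"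
    then obtain a where a: "a \<in> G" "p = g a" by blast
    have "le' a (e q)" "e q \<in> P" using pq a ge unfolding le'_def P_def by auto
    then have "e q \<in> G" using G(1) a unfolding filter_in_def by blast
    then show "q \<in> g ` G" using ge[OF pq(2)] by (metis imageI)
  next
    fix p q assume "p \<in> g ` G" "q \<in> g ` G"
    then show "\<exists>r\<in>g ` G. le r p \<and> le r q"
      using G(1) unfolding filter_in_def le'_def by blast
  qed
  moreover have "g ` G \<inter> D \<noteq> {}" if "D \<in> \<D>" for D
  proof -
    obtain d where d: "d \<in> D" "e d \<in> G" using G(2)[OF \<open>D \<in> \<D>\<close>] by auto
    have "d \<in> Q" using D(1)[OF \<open>D \<in> \<D>\<close>] d(1) unfolding dense_in_def by blast
    then have "d \<in> g ` G" using ge d(2) by (metis imageI)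
    then show ?thesis using d(1) by blast
  qed
  ultimately show ?thesis by blast
qed

section \<open>The forcing notion\<close>

text \<open>Recursive choice: at stage \<open>n\<close> the set to avoid is \<open>C\<close>
  together with all earlier \<open>D (r k)\<close>, which is still countable, so \<open>pick\<close>
  applies.\<close>

lemma sequence_avoiding:
  fixes D :: "'j \<Rightarrow> 'x set"
  assumes pick: "\<And>C. countable C \<Longrightarrow> \<exists>p\<in>J. D p \<inter> C \<subseteq> R"
    and D: "\<And>p. p \<in> J \<Longrightarrow> countable (D p)" and "countable C"
  shows "\<exists>r :: nat \<Rightarrow> 'j. (\<forall>n. r n \<in> J \<and> D (r n) \<inter> C \<subseteq> R) \<and>
           (\<forall>m n. m \<noteq> n \<longrightarrow> D (r m) \<inter> D (r n) \<subseteq> R)"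
proof -
  have "\<exists>r. \<forall>n::nat. r n \<in> J \<and> D (r n) \<inter> (C \<union> (\<Union>k<n. D (r k))) \<subseteq> R"
  proof (rule dependent_wellorder_choice)
    fix n :: nat and r assume "\<And>k. k < n \<Longrightarrow> r k \<in> J \<and> D (r k) \<inter> (C \<union> (\<Union>i<k. D (r i))) \<subseteq> R"
    then have "countable (C \<union> (\<Union>k<n. D (r k)))" using D assms(3) by auto
    then show "\<exists>p. p \<in> J \<and> D p \<inter> (C \<union> (\<Union>k<n. D (r k))) \<subseteq> R" using pick by blast
  qed auto
  then obtain r where r: "\<And>n::nat. r n \<in> J \<and> D (r n) \<inter> (C \<union> (\<Union>k<n. D (r k))) \<subseteq> R" by blast
  have "D (r m) \<inter> D (r n) \<subseteq> R" if "m \<noteq> n" for m n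
    using r[of m] r[of n] that by (cases "m < n") (auto dest: nat_neq_iff[THEN iffD1])
  then show ?thesis using r by blast
qed

text \<open>A condition is a finite partial function, represented by its graph. It colours points
  \<open>Inl x\<close> and assigns thresholds to members \<open>Inr A\<close>; it promises that each colour at or above
  the threshold of \<open>A\<close> is used at most once on \<open>A\<close>.\<close>

definition conditions :: "'b set set \<Rightarrow> (('b + 'b set) \<times> nat) set set" where
  "conditions \<A> = {p. finite p \<and> p \<subseteq> (Inl ` \<Union>\<A> \<union> Inr ` \<A>) \<times> UNIV \<and> single_valued p \<and>
     (\<forall>A n x y k. (Inr A, n) \<in> p \<longrightarrow> (Inl x, k) \<in> p \<longrightarrow> (Inl y, k) \<in> p \<longrightarrow>
        x \<in> A \<longrightarrow> y \<in> A \<longrightarrow> x \<noteq> y \<longrightarrow> k < n)}"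

lemma conditionsD:
  assumes "p \<in> conditions \<A>"
  shows "finite p" "single_valued p"
    "Inl x \<in> Domain p \<Longrightarrow> x \<in> \<Union>\<A>" "Inr A \<in> Domain p \<Longrightarrow> A \<in> \<A>"
    "(Inr A, n) \<in> p \<Longrightarrow> (Inl x, k) \<in> p \<Longrightarrow> (Inl y, k) \<in> p \<Longrightarrow> x \<in> A \<Longrightarrow> y \<in> A \<Longrightarrow> x \<noteq> y \<Longrightarrow> k < n"
  using assms unfolding conditions_def by blast+

lemma finite_Domain_vimage:
  assumes "p \<in> conditions \<A>" "inj h"
  shows "finite (h -` Domain p)"
  using finite_Domain[OF conditionsD(1)[OF assms(1)]] assms(2) by (rule finite_vimageI)

text \<open>If \<open>p\<close> promises \<open>A\<close>, then \<open>pq\<close> ensures that all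
  points of \<open>A\<close> coloured by \<open>p \<union> q\<close> are coloured by
  \<open>p\<close> already, so the promise of \<open>p\<close> suffices; \<open>qp\<close> does the
  same for \<open>q\<close>. Members in the common part \<open>R\<close> count as promises of
  \<open>p\<close>, hence the asymmetry of the two hypotheses.\<close>

lemma conditions_union:
  assumes p: "p \<in> conditions \<A>" and q: "q \<in> conditions \<A>" and R: "R \<subseteq> p" "R \<subseteq> q"
    and dom: "Domain p \<inter> Domain q \<subseteq> Domain R"
    and pq: "\<And>A x. Inr A \<in> Domain p \<Longrightarrow> Inl x \<in> Domain q \<Longrightarrow> x \<in> A \<Longrightarrow> Inl x \<in> Domain R"
    and qp: "\<And>A x. Inr A \<in> Domain q - Domain R \<Longrightarrow> Inl x \<in> Domain p \<Longrightarrow> x \<in> A \<Longrightarrow>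
       Inl x \<in> Domain R"
  shows "p \<union> q \<in> conditions \<A>"
proof -
  note svp = conditionsD(2)[OF p] and svq = conditionsD(2)[OF q]
  have toR: "(z, k) \<in> R" if "(z, k) \<in> p \<or> (z, k) \<in> q" "z \<in> Domain R" for z k
    using that R svp svq by (auto dest: single_valuedD)
  have "single_valued (p \<union> q)"
  proof (rule single_valuedI)
    fix z k l assume "(z, k) \<in> p \<union> q" "(z, l) \<in> p \<union> q"
    then show "k = l"
      using toR[of z k] toR[of z l] dom R svp svq by (blast dest: single_valuedD)
  qed
  moreover have "k < n"
    if h: "(Inr A, n) \<in> p \<union> q" "(Inl x, k) \<in> p \<union> q" "(Inl y, k) \<in> p \<union> q"
      "x \<in> A" "y \<in> A" "x \<noteq> y" for A n x y k
  proof (cases "(Inr A, n) \<in> p")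
    case True
    then have "(Inl z, k) \<in> p" if "(Inl z, k) \<in> p \<union> q" "z \<in> A" for z
      using that pq[of A z] toR[of "Inl z" k] R by blast
    then show ?thesis using conditionsD(5)[OF p True] h by blast
  next
    case False
    then have A: "(Inr A, n) \<in> q" "Inr A \<in> Domain q - Domain R"
      using h(1) toR[of "Inr A" n] R by auto
    then have "(Inl z, k) \<in> q" if "(Inl z, k) \<in> p \<union> q" "z \<in> A" for z
      using that qp[of A z] toR[of "Inl z" k] R by blast
    then show ?thesis using conditionsD(5)[OF q A(1)] h by blast
  qed
  ultimately show ?thesis using p q unfolding conditions_def by blast
qed

locale almost_disjoint =
  fixes \<A> :: "'b set set"
  assumes countable_members: "A \<in> \<A> \<Longrightarrow> countable A"
    and infinite_members: "A \<in> \<A> \<Longrightarrow> infinite A"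
    and finite_Int_members: "A \<in> \<A> \<Longrightarrow> B \<in> \<A> \<Longrightarrow> A \<noteq> B \<Longrightarrow> finite (A \<inter> B)"
begin

lemma forcing_order_conditions: "forcing_order (conditions \<A>) (\<lambda>q p. p \<subseteq> q)"
proof -
  have "{} \<in> conditions \<A>" by (simp add: conditions_def)
  then show ?thesis unfolding forcing_order_def by blast
qed

lemma card_of_Union_members:
  assumes "|\<A>| \<le>o omega1"
  shows "|\<Union>\<A>| \<le>o omega1"
proof -
  have "|\<Union>A\<in>\<A>. A| \<le>o omega1"
    by (rule UNION_Cinfinite_bound[OF assms _ Cinfinite_omega1])
      (use countable_members countable_imp_ordLeq_omega1 in blast)
  then show ?thesis by simp
qed

text \<open>This bound is what allows the order to be copied into an uncountable type.\<close>

lemma card_of_conditions: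
  assumes "|\<A>| \<le>o omega1"
  shows "|conditions \<A>| \<le>o omega1"
proof -
  have "|Inl ` \<Union>\<A> :: ('b + 'b set) set| \<le>o omega1"
      "|Inr ` \<A> :: ('b + 'b set) set| \<le>o omega1"
    using assms card_of_Union_members[OF assms] card_of_image ordLeq_transitive by blast+
  then have "|Inl ` \<Union>\<A> \<union> Inr ` \<A>| \<le>o omega1"
    using Un_Cinfinite_bound Cinfinite_omega1 by blast
  then have "|(Inl ` \<Union>\<A> \<union> Inr ` \<A>) \<times> (UNIV :: nat set)| \<le>o omega1"
    using card_of_Times_ordLeq_infinite_Field[OF Field_omega1]
      countable_imp_ordLeq_omega1[of "UNIV :: nat set"] Cinfinite_omega1 by blast
  then have "|{p. finite p \<and> p \<subseteq> (Inl ` \<Union>\<A> \<union> Inr ` \<A>) \<times> (UNIV :: nat set)}| \<le>o omega1"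
    by (rule card_of_finite_subsets[OF Cinfinite_omega1])
  moreover have "conditions \<A> \<subseteq> {p. finite p \<and> p \<subseteq> (Inl ` \<Union>\<A> \<union> Inr ` \<A>) \<times> UNIV}"
    unfolding conditions_def by blast
  ultimately show ?thesis by (rule ordLeq_transitive[OF card_of_mono1, rotated])
qed

section \<open>The countable chain condition\<close>

lemma ccc_conditions: "ccc (conditions \<A>) (\<lambda>q p. p \<subseteq> q)"
  unfolding ccc_def
proof (intro allI impI, rule ccontr)
  fix X assume X: "X \<subseteq> conditions \<A>"
    and X_anti: "\<forall>p\<in>X. \<forall>q\<in>X. p \<noteq> q \<longrightarrow> \<not> compatible (conditions \<A>) (\<lambda>q p. p \<subseteq> q) p q"
    and unc: "\<not> countable X"
  have anti: "p = q" if "p \<in> X" "q \<in> X" "p \<union> q \<in> conditions \<A>" for p q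
  proof -
    have "compatible (conditions \<A>) (\<lambda>q p. p \<subseteq> q) p q"
      unfolding compatible_def using that(3) by (intro bexI[of _ "p \<union> q"]) auto
    then show ?thesis using X_anti that(1,2) by metis
  qed
  \<comment> \<open>The common size \<open>m\<close> bounds the root here and the number of points
    in the pigeonhole argument later.\<close>
  have "X = (\<Union>m. {p \<in> X. card p = m})" by auto
  then obtain m where m: "\<not> countable {p \<in> X. card p = m}"
    using unc by (metis (lifting) countable_UN countableI_type)
  define Y where "Y = {p \<in> X. card p = m}"
  have Y: "\<not> countable Y" "p \<in> Y \<Longrightarrow> p \<in> conditions \<A>" "p \<in> Y \<Longrightarrow> card p = m"
      "p \<in> Y \<Longrightarrow> finite p" for p
    using m X conditionsD(1) unfolding Y_def by auto
  \<comment> \<open>A maximal set contained in uncountably many conditions replaces the root of a delta system.\<close>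
  define large where "large S \<longleftrightarrow> \<not> countable {p \<in> Y. S \<subseteq> p}" for S
  have large_card: "finite S \<and> card S \<le> m" if "large S" for S
  proof -
    obtain p where "p \<in> Y" "S \<subseteq> p"
      using \<open>large S\<close> unfolding large_def by (metis (mono_tags, lifting) countable_empty empty_Collect_eq)
    then show ?thesis using Y(3,4) by (metis card_mono finite_subset)
  qed
  have "large {}" using Y(1) by (simp add: large_def)
  \<comment> \<open>A large set lies inside a condition of size \<open>m\<close>, so sizes of large
    sets are bounded; the strict bound is \<open>Suc m\<close>.\<close>
  then obtain R where R: "large R" "\<And>S. large S \<Longrightarrow> card S \<le> card R"
    using ex_has_greatest_nat[of large "{}" card "Suc m"] large_card by (metis le_imp_less_Suc)
  \<comment> \<open>Strict inclusion discards at most \<open>R\<close> itself and forces every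
    condition in \<open>J\<close> to have domain elements outside \<open>Domain R\<close>.\<close>
  define J where "J = {p \<in> Y. R \<subset> p}"
  have "{p \<in> Y. R \<subseteq> p} \<subseteq> insert R J" unfolding J_def by auto
  then have uncJ: "\<not> countable J"
    using R(1) unfolding large_def by (meson countable_insert countable_subset)
  have J: "p \<in> X" "p \<in> conditions \<A>" "finite p" "R \<subseteq> p" "card p = m" if "p \<in> J" for p
  proof -
    have "p \<in> Y" "R \<subseteq> p" using that unfolding J_def by auto
    then show "p \<in> conditions \<A>" "finite p" "R \<subseteq> p" "card p = m"
      by (auto intro: Y)
    show "p \<in> X" using \<open>p \<in> Y\<close> unfolding Y_def by blast
  qed
  have Jdom: "\<not> Domain p \<subseteq> Domain R" if "p \<in> J" for p
  proof
    assume "Domain p \<subseteq> Domain R"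
    then have "p \<subseteq> R"
      using J(4)[OF that] conditionsD(2)[OF J(2)[OF that]] by (fastforce dest: single_valuedD)
    then show False using that unfolding J_def by blast
  qed
  \<comment> \<open>Maximality of \<open>R\<close>: if uncountably many conditions shared
    \<open>(z, k)\<close>, then \<open>insert (z, k) R\<close> would be a bigger large set. There
    are only countably many values \<open>k\<close>.\<close>
  have thin: "countable {p \<in> J. z \<in> Domain p}" if z: "z \<notin> Domain R" for z
  proof -
    have "countable {p \<in> J. (z, k) \<in> p}" for k
    proof (rule ccontr)
      assume "\<not> countable {p \<in> J. (z, k) \<in> p}"
      moreover have "{p \<in> J. (z, k) \<in> p} \<subseteq> {p \<in> Y. insert (z, k) R \<subseteq> p}"
        unfolding J_def by auto
      ultimately have "large (insert (z, k) R)" unfolding large_def using countable_subset by blast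
      then have "card (insert (z, k) R) \<le> card R" by (rule R(2))
      moreover have "finite R" "(z, k) \<notin> R" using z large_card[OF R(1)] by auto
      ultimately show False by simp
    qed
    then have "countable (\<Union>k. {p \<in> J. (z, k) \<in> p})" by auto
    then show ?thesis by (rule countable_subset[rotated]) auto
  qed
  \<comment> \<open>Otherwise \<open>J\<close> would be covered by the countable sets of
    \<open>thin\<close>, with \<open>z\<close> ranging over the countable set
    \<open>C - Domain R\<close>.\<close>
  have pick: "\<exists>p\<in>J. Domain p \<inter> C \<subseteq> Domain R" if "countable C" for C
  proof (rule ccontr)
    assume none: "\<not> ?thesis"
    have "J \<subseteq> (\<Union>z\<in>C - Domain R. {p \<in> J. z \<in> Domain p})"
    proof
      fix p assume "p \<in> J"
      then have "\<not> Domain p \<inter> C \<subseteq> Domain R" using none by metis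
      then obtain z where "z \<in> C - Domain R" "z \<in> Domain p" by auto
      then show "p \<in> (\<Union>z\<in>C - Domain R. {p \<in> J. z \<in> Domain p})"
        using \<open>p \<in> J\<close> by (intro UN_I[of z]) simp_all
    qed
    moreover have "countable (\<Union>z\<in>C - Domain R. {p \<in> J. z \<in> Domain p})"
      using thin \<open>countable C\<close> by (intro countable_UN) auto
    ultimately show False using uncJ countable_subset by blast
  qed
  have cD: "countable (Domain p)" if "p \<in> J" for p
    using J(3)[OF that] by (simp add: countable_finite finite_Domain)
  obtain p where p: "\<And>n. p n \<in> J" "\<And>k n::nat. k \<noteq> n \<Longrightarrow> Domain (p k) \<inter> Domain (p n) \<subseteq> Domain R"
    using sequence_avoiding[OF pick cD countable_empty] by blast
  \<comment> \<open>Besides the domains of all \<open>p n\<close>, the set contains every point of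
    every member they promise, including members promised by the root. The \<open>q i\<close> avoid
    it outside \<open>Domain R\<close>, which gives hypothesis \<open>pq\<close> of
    \<open>conditions_union\<close>.\<close>
  define C where
    "C = (\<Union>n. Domain (p n)) \<union> (\<Union>n. \<Union>A\<in>{A. Inr A \<in> Domain (p n)}. Inl ` A)"
  have "countable {A. Inr A \<in> Domain (p n)}" for n
    using countable_finite[OF finite_Domain_vimage[OF J(2)[OF p(1)[of n]] inj_Inr]]
    by (simp add: vimage_def)
  moreover have "countable A" if "Inr A \<in> Domain (p n)" for A n
    using that countable_members conditionsD(4)[OF J(2)[OF p(1)]] by blast
  ultimately have C: "countable C" unfolding C_def using cD[OF p(1)] by (intro countable_Un countable_UN) auto
  obtain q where q: "\<And>i. q i \<in> J" "\<And>i. Domain (q i) \<inter> C \<subseteq> Domain R"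
      "\<And>i j::nat. i \<noteq> j \<Longrightarrow> Domain (q i) \<inter> Domain (q j) \<subseteq> Domain R"
    using sequence_avoiding[OF pick cD C] by blast
  \<comment> \<open>The negation is exactly the remaining hypothesis \<open>qp\<close> for
    amalgamating \<open>p n\<close> and \<open>q i\<close>. The antichain then forces
    \<open>p n = q i\<close>, whose domain would lie in \<open>C\<close> and hence in
    \<open>Domain R\<close>.\<close>
  have meet: "\<exists>x A. Inl x \<in> Domain (p n) - Domain R \<and> Inr A \<in> Domain (q i) - Domain R \<and> x \<in> A"
    for n i
  proof (rule ccontr)
    assume no: "\<not> ?thesis"
    have pC: "Domain (p n) \<subseteq> C" unfolding C_def by blast
    have "p n \<union> q i \<in> conditions \<A>"
    proof (rule conditions_union[OF J(2)[OF p(1)] J(2)[OF q(1)] J(4)[OF p(1)] J(4)[OF q(1)]])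
      show "Domain (p n) \<inter> Domain (q i) \<subseteq> Domain R" using q(2) pC by blast
      show "Inl x \<in> Domain R" if "Inr A \<in> Domain (p n)" "Inl x \<in> Domain (q i)" "x \<in> A" for A x
        using that q(2)[of i] unfolding C_def by blast
      show "Inl x \<in> Domain R"
        if "Inr A \<in> Domain (q i) - Domain R" "Inl x \<in> Domain (p n)" "x \<in> A" for A x
        using that no by blast
    qed
    then have "p n = q i" using anti J(1) p(1) q(1) by blast
    then show False using Jdom[OF q(1)[of i]] q(2)[of i] pC by (simp add: Int_absorb2)
  qed
  define M where "M i = {A. Inr A \<in> Domain (q i) - Domain R}" for i
  have finM: "finite (M i)" for i
    by (rule finite_subset[OF _ finite_Domain_vimage[OF J(2)[OF q(1)[of i]] inj_Inr]])
      (auto simp: M_def)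
  have MA: "M i \<subseteq> \<A>" for i using conditionsD(4)[OF J(2)[OF q(1)]] unfolding M_def by blast
  \<comment> \<open>New parts of different \<open>q i\<close> are disjoint, so members taken from
    them are distinct and meet in finite sets.\<close>
  have Mdisj: "A \<noteq> B" if "i \<noteq> j" "A \<in> M i" "B \<in> M j" for i j A B
    using q(3)[OF that(1)] that(2,3) unfolding M_def by blast
  \<comment> \<open>Each \<open>p n\<close> has at most \<open>m\<close> points but meets members of \<open>q 0, ..., q m\<close>, so two of
    these members share a point of \<open>p n\<close>; distinct \<open>n\<close> give distinct points.\<close>
  define E where "E = (\<Union>i\<le>m. \<Union>j\<in>{..m} - {i}. \<Union>A\<in>M i. \<Union>B\<in>M j. A \<inter> B)"
  have "finite E" unfolding E_def
    using finM MA Mdisj by (intro finite_UN_I finite_Int_members) (auto, blast+)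
  have "\<exists>x\<in>E. Inl x \<in> Domain (p n) - Domain R" for n
  proof -
    obtain x A where xA: "\<And>i. Inl (x i) \<in> Domain (p n) - Domain R" "\<And>i. A i \<in> M i" "\<And>i. x i \<in> A i"
      using meet[of n] unfolding M_def mem_Collect_eq by metis
    \<comment> \<open>The indices \<open>0, ..., m\<close> number \<open>m + 1\<close>, but
      \<open>Domain (p n)\<close> has at most \<open>m\<close> elements.\<close>
    have "\<not> inj_on x {..m}"
    proof
      assume "inj_on x {..m}"
      then have "card ((Inl \<circ> x) ` {..m} :: ('b + 'b set) set) = Suc m"
        by (subst card_image) (auto simp: inj_on_def)
      moreover have "(Inl \<circ> x) ` {..m} \<subseteq> Domain (p n)" using xA(1) by auto
      moreover have "card (Domain (p n)) \<le> m"
        using card_image_le[of "p n" fst] J(3,5)[OF p(1)] by (simp add: Domain_fst)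
      ultimately show False
        using card_mono[OF finite_Domain[OF J(3)[OF p(1)[of n]]]] by (metis not_less_eq_eq le_trans)
    qed
    then obtain i j where ij: "i \<le> m" "j \<le> m" "i \<noteq> j" "x i = x j" by (auto simp: inj_on_def)
    then have "x i \<in> E" unfolding E_def using xA(2,3)[of i] xA(2,3)[of j] by auto
    then show ?thesis using xA(1) by blast
  qed
  then obtain x where x: "\<And>n. x n \<in> E" "\<And>n. Inl (x n) \<in> Domain (p n) - Domain R" by metis
  have "inj x"
  proof (rule injI)
    fix k n assume "x k = x n"
    then show "k = n" using x(2)[of k] x(2)[of n] p(2)[of k n] by auto
  qed
  moreover have "range x \<subseteq> E" using x(1) by blast
  ultimately show False using \<open>finite E\<close> by (metis finite_subset range_inj_infinite)
qed

section \<open>One-step extensions of conditions and the dense sets\<close>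

lemma insert_Inl_condition:
  assumes p: "p \<in> conditions \<A>" and x: "x \<in> \<Union>\<A>" "Inl x \<notin> Domain p"
    and k: "\<And>A n y. (Inr A, n) \<in> p \<Longrightarrow> x \<in> A \<Longrightarrow> y \<in> A \<Longrightarrow> (Inl y, k) \<in> p \<Longrightarrow> k < n"
  shows "insert (Inl x, k) p \<in> conditions \<A>"
proof -
  have "single_valued (insert (Inl x, k) p)"
    using conditionsD(2)[OF p] x(2) unfolding single_valued_def by blast
  moreover have "l < n"
    if h: "(Inr A, n) \<in> insert (Inl x, k) p" "(Inl y, l) \<in> insert (Inl x, k) p"
      "(Inl z, l) \<in> insert (Inl x, k) p" "y \<in> A" "z \<in> A" "y \<noteq> z" for A n y z l
    using h conditionsD(5)[OF p, of A n y l z] k[of A n y] k[of A n z] by auto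
  moreover have "finite p" "p \<subseteq> (Inl ` \<Union>\<A> \<union> Inr ` \<A>) \<times> UNIV"
    using p unfolding conditions_def by auto
  ultimately show ?thesis using x(1) unfolding conditions_def by blast
qed

text \<open>A threshold above every number occurring in \<open>p\<close> makes the new promise
  vacuous for the points coloured so far.\<close>

lemma insert_Inr_condition:
  assumes p: "p \<in> conditions \<A>" and A: "A \<in> \<A>" "Inr A \<notin> Domain p"
  shows "\<exists>n. insert (Inr A, n) p \<in> conditions \<A>"
proof -
  obtain n where n: "\<And>k. k \<in> Range p \<Longrightarrow> k < n"
    using conditionsD(1)[OF p] finite_Range finite_nat_set_iff_bounded by metis
  have "single_valued (insert (Inr A, n) p)"
    using conditionsD(2)[OF p] A(2) unfolding single_valued_def by blast
  moreover have "l < i"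
    if h: "(Inr B, i) \<in> insert (Inr A, n) p" "(Inl y, l) \<in> insert (Inr A, n) p"
      "(Inl z, l) \<in> insert (Inr A, n) p" "y \<in> B" "z \<in> B" "y \<noteq> z" for B i y z l
    using h conditionsD(5)[OF p, of B i y l z] n[of l] by auto
  moreover have "finite p" "p \<subseteq> (Inl ` \<Union>\<A> \<union> Inr ` \<A>) \<times> UNIV"
    using p unfolding conditions_def by auto
  ultimately show ?thesis using A(1) unfolding conditions_def by blast
qed

definition colouring :: "'b \<Rightarrow> (('b + 'b set) \<times> nat) set set" where
  "colouring x = {p \<in> conditions \<A>. Inl x \<in> Domain p}"

text \<open>A filter meeting these sets for all \<open>k\<close> assigns \<open>A\<close> a
  threshold and makes every colour from that threshold on occur in \<open>A\<close>.\<close>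

definition attaining :: "'b set \<times> nat \<Rightarrow> (('b + 'b set) \<times> nat) set set" where
  "attaining = (\<lambda>(A, k). {p \<in> conditions \<A>. \<exists>n. (Inr A, n) \<in> p \<and> (k < n \<or> (\<exists>x\<in>A. (Inl x, k) \<in> p))})"

lemma dense_colouring:
  assumes x: "x \<in> \<Union>\<A>"
  shows "dense_in (conditions \<A>) (\<lambda>q p. p \<subseteq> q) (colouring x)"
proof -
  have "\<exists>q\<in>colouring x. p \<subseteq> q" if p: "p \<in> conditions \<A>" for p
  proof (cases "Inl x \<in> Domain p")
    case True
    then show ?thesis using p unfolding colouring_def by blast
  next
    case False
    \<comment> \<open>A fresh colour cannot repeat one already used, so no promise is
      endangered.\<close>
    obtain k where "k \<notin> Range p"
      using conditionsD(1)[OF p] finite_Range ex_new_if_finite infinite_UNIV_nat by metis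
    then have "insert (Inl x, k) p \<in> conditions \<A>"
      using insert_Inl_condition[OF p x False, of k] by blast
    then show ?thesis unfolding colouring_def by blast
  qed
  then show ?thesis unfolding dense_in_def colouring_def by blast
qed

text \<open>First give \<open>A\<close> a threshold. If \<open>k\<close> is at or above it and still
  missing on \<open>A\<close>, remove from the infinite set \<open>A\<close> the finitely many
  coloured points and the finite intersections with the other promised members. A remaining point
  lies in no promised member but \<open>A\<close>, so it can safely receive colour
  \<open>k\<close>.\<close>

lemma dense_attaining:
  assumes A: "A \<in> \<A>"
  shows "dense_in (conditions \<A>) (\<lambda>q p. p \<subseteq> q) (attaining (A, k))"
proof -
  have "\<exists>q\<in>attaining (A, k). p \<subseteq> q" if "p \<in> conditions \<A>" for p
  proof -
    obtain q n where q: "q \<in> conditions \<A>" "p \<subseteq> q" "(Inr A, n) \<in> q"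
      using insert_Inr_condition[OF \<open>p \<in> conditions \<A>\<close> A] \<open>p \<in> conditions \<A>\<close> by blast
    show ?thesis
    proof (cases "k < n \<or> (\<exists>x\<in>A. (Inl x, k) \<in> q)")
      case True
      then show ?thesis using q unfolding attaining_def by blast
    next
      case False
      have "finite (\<Union>B\<in>(Inr -` Domain q) - {A}. A \<inter> B)"
        using finite_Domain_vimage[OF q(1), of Inr] conditionsD(4)[OF q(1)] A
        by (intro finite_UN_I finite_Int_members) auto
      then have "infinite (A - (Inl -` Domain q \<union> (\<Union>B\<in>(Inr -` Domain q) - {A}. A \<inter> B)))"
        using infinite_members[OF A] finite_Domain_vimage[OF q(1), of Inl]
        by (metis Diff_infinite_finite finite_Un inj_Inl)
      then obtain x where
        "x \<in> A - (Inl -` Domain q \<union> (\<Union>B\<in>(Inr -` Domain q) - {A}. A \<inter> B))"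
        using ex_in_conv[THEN iffD2, OF infinite_imp_nonempty] by metis
      then have
        x: "x \<in> A" "Inl x \<notin> Domain q" "\<And>B. Inr B \<in> Domain q \<Longrightarrow> x \<in> B \<Longrightarrow> B = A"
        by auto
      have "insert (Inl x, k) q \<in> conditions \<A>"
        using insert_Inl_condition[OF q(1) _ x(2), of k] A x(1,3) False by blast
      then show ?thesis using q x(1) unfolding attaining_def by blast
    qed
  qed
  then show ?thesis unfolding dense_in_def attaining_def by blast
qed

end

section \<open>The colouring read off from a generic filter\<close>

lemma MA_omega1_almost_disjoint:
  fixes \<A> :: "'b set set"
  assumes MA: "MA_omega1 TYPE('p)" and unc: "\<not> countable (UNIV :: 'p set)"
    and "almost_disjoint \<A>" and card: "|\<A>| \<le>o omega1"
  shows "\<exists>f::'b \<Rightarrow> nat. \<forall>A\<in>\<A>. finite (UNIV - I_f f (\<Union>\<A>) A)"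
proof -
  interpret almost_disjoint \<A> by fact
  define \<D> where "\<D> = colouring ` \<Union>\<A> \<union> attaining ` (\<A> \<times> UNIV)"
  have "|colouring ` \<Union>\<A>| \<le>o omega1"
    by (rule ordLeq_transitive[OF card_of_image card_of_Union_members[OF card]])
  moreover have "|\<A> \<times> (UNIV :: nat set)| \<le>o omega1"
    using card_of_Times_ordLeq_infinite_Field[OF Field_omega1 card]
      countable_imp_ordLeq_omega1[of "UNIV :: nat set"] Cinfinite_omega1 by blast
  then have "|attaining ` (\<A> \<times> UNIV)| \<le>o omega1"
    using card_of_image ordLeq_transitive by blast
  ultimately have "|\<D>| \<le>o omega1"
    unfolding \<D>_def using Un_Cinfinite_bound Cinfinite_omega1 by blast
  moreover have "dense_in (conditions \<A>) (\<lambda>q p. p \<subseteq> q) D" if "D \<in> \<D>" for D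
    using that dense_colouring dense_attaining unfolding \<D>_def by blast
  ultimately obtain G where G: "filter_in (conditions \<A>) (\<lambda>q p. p \<subseteq> q) G"
      and gen: "\<And>D. D \<in> \<D> \<Longrightarrow> G \<inter> D \<noteq> {}"
    using MA_omega1_transfer[OF MA unc forcing_order_conditions ccc_conditions
      card_of_conditions[OF card], of \<D>] by blast
  have GP: "p \<in> conditions \<A>" if "p \<in> G" for p
    using G that by (auto simp: filter_in_def)
  have dir: "\<exists>r\<in>G. p \<union> q \<subseteq> r" if "p \<in> G" "q \<in> G" for p q
    using G that by (simp add: filter_in_def)
  \<comment> \<open>Two conditions in \<open>G\<close> have a common extension in \<open>G\<close>,
    which is single-valued.\<close>
  have sv: "k = l" if kl: "(z, k) \<in> \<Union>G" "(z, l) \<in> \<Union>G" for z k l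
  proof -
    obtain p q where pq: "p \<in> G" "q \<in> G" "(z, k) \<in> p" "(z, l) \<in> q" using kl by blast
    then obtain r where "r \<in> G" "p \<union> q \<subseteq> r" using dir by blast
    then show ?thesis using pq conditionsD(2)[OF GP] by (blast dest: single_valuedD)
  qed
  have "\<exists>k. (Inl x, k) \<in> \<Union>G" if "x \<in> \<Union>\<A>" for x
    using gen[of "colouring x"] that unfolding \<D>_def colouring_def by blast
  then obtain f where f: "\<And>x. x \<in> \<Union>\<A> \<Longrightarrow> (Inl x, f x) \<in> \<Union>G" by metis
  have "finite (UNIV - I_f f (\<Union>\<A>) A)" if A: "A \<in> \<A>" for A
  proof -
    have att: "\<exists>n. (Inr A, n) \<in> \<Union>G \<and> (k < n \<or> (\<exists>x\<in>A. (Inl x, k) \<in> \<Union>G))" for k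
      using gen[of "attaining (A, k)"] A unfolding \<D>_def attaining_def by blast
    then obtain n where n: "(Inr A, n) \<in> \<Union>G" by blast
    have "k \<in> I_f f (\<Union>\<A>) A" if "n \<le> k" for k
    proof -
      \<comment> \<open>The threshold supplied by \<open>att\<close> for \<open>k\<close> is the
        same \<open>n\<close>, by \<open>sv\<close>; as \<open>n \<le> k\<close>, the colour must be
        attained.\<close>
      obtain x where x: "x \<in> A" "(Inl x, k) \<in> \<Union>G"
        using att[of k] sv n \<open>n \<le> k\<close> by (metis not_le)
      have fx: "f x = k" using sv f x A by blast
      have "y = x" if y: "y \<in> A" "f y = k" for y
      proof (rule ccontr)
        assume "y \<noteq> x"
        have "(Inl y, k) \<in> \<Union>G" using f y A by blast
        then obtain p q s where pqs: "p \<in> G" "q \<in> G" "s \<in> G"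
            "(Inl y, k) \<in> p" "(Inl x, k) \<in> q" "(Inr A, n) \<in> s"
          using x(2) n by blast
        \<comment> \<open>A single condition \<open>t\<close> in \<open>G\<close> is built that
          contains both coloured points and the threshold of \<open>A\<close>; its promise is
          violated by two points of colour \<open>k\<close>.\<close>
        then obtain r where r: "r \<in> G" "p \<union> q \<subseteq> r" using dir by blast
        then obtain t where t: "t \<in> G" "r \<union> s \<subseteq> t" using dir pqs(3) by blast
        have "k < n"
          using conditionsD(5)[OF GP[OF t(1)], of A n y k x] pqs r t x(1) y(1) \<open>y \<noteq> x\<close> by blast
        then show False using \<open>n \<le> k\<close> by simp
      qed
      then show ?thesis unfolding I_f_def using x(1) fx A by blast
    qed
    then have "UNIV - I_f f (\<Union>\<A>) A \<subseteq> {..<n}" by (auto simp: not_less[symmetric])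
    then show ?thesis using finite_subset by blast
  qed
  then show ?thesis by blast
qed

section \<open>Countable traces of uncountable members\<close>

text \<open>In a well-order of type at most \<open>omega1\<close>, pick from each member a countably infinite set
  disjoint from all earlier members; the union of these sets meets every member countably.\<close>

lemma countable_traces:
  fixes \<A> :: "'b set set"
  assumes card: "|\<A>| \<le>o omega1" and unc: "\<And>A. A \<in> \<A> \<Longrightarrow> \<not> countable A"
    and fin: "\<And>A B. A \<in> \<A> \<Longrightarrow> B \<in> \<A> \<Longrightarrow> A \<noteq> B \<Longrightarrow> finite (A \<inter> B)"
  shows "\<exists>Y. \<forall>A\<in>\<A>. countable (A \<inter> Y) \<and> infinite (A \<inter> Y)"
proof -
  let ?r = "card_of \<A>"
  \<comment> \<open>A proper initial segment of the cardinal well-order has size below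
    \<open>omega1\<close>.\<close>
  have below: "countable (underS ?r A)" if "A \<in> \<A>" for A
    using card_of_underS[OF card_of_Card_order, of A \<A>] that card ordLess_ordLeq_trans
      ordLess_omega1_iff by (metis Field_card_of)
  have lin: "A \<in> underS ?r B \<or> B \<in> underS ?r A" if "A \<in> \<A>" "B \<in> \<A>" "A \<noteq> B" for A B
    using card_of_well_order_on[of \<A>] that
    unfolding underS_def well_order_on_def linear_order_on_def total_on_def by auto
  have sub: "underS ?r A \<subseteq> \<A>" for A
  proof
    fix B assume "B \<in> underS ?r A"
    then show "B \<in> \<A>" using underS_Field[of B ?r A] by (simp add: Field_card_of)
  qed
  \<comment> \<open>The countably many earlier members remove only a countable part of the
    uncountable \<open>A\<close>.\<close>
  have "\<exists>B \<subseteq> A - \<Union>(underS ?r A). countable B \<and> infinite B" if A: "A \<in> \<A>" for A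
  proof -
    have "countable (\<Union>B\<in>underS ?r A. A \<inter> B)"
    proof (rule countable_UN[OF below[OF A]])
      fix B assume "B \<in> underS ?r A"
      then have "B \<in> \<A>" "A \<noteq> B" using sub unfolding underS_def by auto
      then show "countable (A \<inter> B)" using fin[OF A] countable_finite by blast
    qed
    moreover have "A \<subseteq> (\<Union>B\<in>underS ?r A. A \<inter> B) \<union> (A - \<Union>(underS ?r A))" by blast
    ultimately have "infinite (A - \<Union>(underS ?r A))"
      using unc[OF A] by (metis countable_Un countable_finite countable_subset)
    then show ?thesis by (metis infinite_countable_subset')
  qed
  then obtain b where b: "\<And>A. A \<in> \<A> \<Longrightarrow> b A \<subseteq> A - \<Union>(underS ?r A)"
      "\<And>A. A \<in> \<A> \<Longrightarrow> countable (b A)" "\<And>A. A \<in> \<A> \<Longrightarrow> infinite (b A)"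
    by metis
  have "countable (A \<inter> \<Union>(b ` \<A>)) \<and> infinite (A \<inter> \<Union>(b ` \<A>))" if A: "A \<in> \<A>" for A
  proof
    \<comment> \<open>The set picked from a later member avoids \<open>A\<close>, so only
      \<open>A\<close> and its countably many predecessors contribute.\<close>
    have "A \<inter> \<Union>(b ` \<A>) \<subseteq> (\<Union>B\<in>insert A (underS ?r A). b B)"
    proof
      fix x assume "x \<in> A \<inter> \<Union>(b ` \<A>)"
      then obtain B where B: "x \<in> A" "B \<in> \<A>" "x \<in> b B" by blast
      then have "A \<notin> underS ?r B" using b(1)[OF B(2)] by blast
      then have "B \<in> insert A (underS ?r A)" using lin[OF A B(2)] by blast
      then show "x \<in> (\<Union>B\<in>insert A (underS ?r A). b B)" using B(3) by blast
    qed
    moreover have "countable (\<Union>B\<in>insert A (underS ?r A). b B)"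
      using below[OF A] sub b(2) A by (intro countable_UN) auto
    ultimately show "countable (A \<inter> \<Union>(b ` \<A>))" using countable_subset by blast
    have "b A \<subseteq> A \<inter> \<Union>(b ` \<A>)" using b(1)[OF A] A by blast
    then show "infinite (A \<inter> \<Union>(b ` \<A>))" using b(3)[OF A] finite_subset by blast
  qed
  then show ?thesis by blast
qed

lemma MA_omega1_uncountable_members:
  fixes \<A> :: "'b set set"
  assumes MA: "MA_omega1 TYPE('p)" and unc: "\<not> countable (UNIV :: 'p set)"
    and card: "|\<A>| \<le>o omega1" and unc_members: "\<And>A. A \<in> \<A> \<Longrightarrow> \<not> countable A"
    and fin: "\<And>A B. A \<in> \<A> \<Longrightarrow> B \<in> \<A> \<Longrightarrow> A \<noteq> B \<Longrightarrow> finite (A \<inter> B)"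
  shows "\<exists>f::'b \<Rightarrow> nat. \<forall>A\<in>\<A>. finite (UNIV - I_f f (\<Union>\<A>) A)"
proof -
  obtain Y where Y: "\<And>A. A \<in> \<A> \<Longrightarrow> countable (A \<inter> Y)" "\<And>A. A \<in> \<A> \<Longrightarrow> infinite (A \<inter> Y)"
    using countable_traces[OF card unc_members fin] by blast
  define \<B> where "\<B> = (\<lambda>A. A \<inter> Y) ` \<A>"
  have "almost_disjoint \<B>"
  proof
    fix B C assume "B \<in> \<B>" "C \<in> \<B>" "B \<noteq> C"
    then obtain A A' where "A \<in> \<A>" "A' \<in> \<A>" "B = A \<inter> Y" "C = A' \<inter> Y" "A \<noteq> A'"
      unfolding \<B>_def by blast
    then show "finite (B \<inter> C)"
      using fin[of A A'] by (auto intro: finite_subset[of _ "A \<inter> A'"])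
  qed (use Y in \<open>auto simp: \<B>_def\<close>)
  moreover have "|\<B>| \<le>o omega1"
    unfolding \<B>_def using card_of_image card ordLeq_transitive by blast
  ultimately obtain f :: "'b \<Rightarrow> nat" where f: "\<And>B. B \<in> \<B> \<Longrightarrow> finite (UNIV - I_f f (\<Union>\<B>) B)"
    using MA_omega1_almost_disjoint[OF MA unc] by blast
  define g where "g x = (if x \<in> Y then f x else 0)" for x
  have "finite (UNIV - I_f g (\<Union>\<A>) A)" if A: "A \<in> \<A>" for A
  proof -
    \<comment> \<open>Points outside \<open>Y\<close> all have colour 0, so for nonzero
      \<open>k\<close> the points of \<open>A\<close> with \<open>g\<close>-colour \<open>k\<close>
      are those of the trace with \<open>f\<close>-colour \<open>k\<close>. At most the colour 0 is
      lost.\<close>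
    have "k \<in> I_f g (\<Union>\<A>) A" if k: "k \<in> I_f f (\<Union>\<B>) (A \<inter> Y)" "k \<noteq> 0" for k
    proof -
      have ex1: "\<exists>!x. x \<in> A \<inter> Y \<and> f x = k" using k(1) unfolding I_f_def by blast
      moreover have "x \<in> A \<inter> Y \<and> f x = k \<longleftrightarrow> x \<in> A \<and> g x = k" for x
        using k(2) unfolding g_def by auto
      ultimately have "\<exists>!x. x \<in> A \<and> g x = k" by simp
      then show ?thesis unfolding I_f_def using A by blast
    qed
    then have "UNIV - I_f g (\<Union>\<A>) A \<subseteq> insert 0 (UNIV - I_f f (\<Union>\<B>) (A \<inter> Y))" by blast
    moreover have "finite (insert 0 (UNIV - I_f f (\<Union>\<B>) (A \<inter> Y)))"
      using f[of "A \<inter> Y"] A unfolding \<B>_def by blast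
    ultimately show ?thesis using finite_subset by blast
  qed
  then show ?thesis by blast
qed

theorem theorem10p4:
  assumes "MA_omega1 TYPE('p)"
    and "\<not> countable (UNIV :: 'p set)"
  shows "arrow_omega TYPE('b) omega1 natLeq natLeq \<and> arrow_omega TYPE('b) omega1 omega1 natLeq"
proof
  have system: "|\<A>| \<le>o omega1" "\<And>A. A \<in> \<A> \<Longrightarrow> |A| =o kap"
      "\<And>A B. A \<in> \<A> \<Longrightarrow> B \<in> \<A> \<Longrightarrow> A \<noteq> B \<Longrightarrow> finite (A \<inter> B)"
    if "is_system \<A> omega1 kap natLeq" for \<A> :: "'b set set" and kap :: "'k rel"
    using that by (auto simp: is_system_def finite_iff_ordLess_natLeq intro: ordIso_imp_ordLeq)
  show "arrow_omega TYPE('b) omega1 natLeq natLeq"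
    unfolding arrow_omega_def
  proof (intro allI impI)
    fix \<A> :: "'b set set" assume sys: "is_system \<A> omega1 natLeq natLeq"
    have "almost_disjoint \<A>"
    proof
      fix A assume "A \<in> \<A>"
      then have "|A| =o natLeq" by (rule system(2)[OF sys])
      then show "countable A" "infinite A"
        by (simp_all add: countable_card_le_natLeq finite_iff_ordLess_natLeq ordIso_imp_ordLeq
            not_ordLess_ordIso)
          (metis not_ordLess_ordIso)
    qed (rule system(3)[OF sys])
    then show "\<exists>f::'b \<Rightarrow> nat. \<forall>A\<in>\<A>. finite (UNIV - I_f f (\<Union>\<A>) A)"
      by (rule MA_omega1_almost_disjoint[OF assms _ system(1)[OF sys]])
  qed
  show "arrow_omega TYPE('b) omega1 omega1 natLeq"
    unfolding arrow_omega_def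
  proof (intro allI impI)
    fix \<A> :: "'b set set" assume sys: "is_system \<A> omega1 omega1 natLeq"
    have "\<not> countable A" if "A \<in> \<A>" for A
      using system(2)[OF sys that] ordLess_omega1_iff[of A] not_ordLess_ordIso by metis
    then show "\<exists>f::'b \<Rightarrow> nat. \<forall>A\<in>\<A>. finite (UNIV - I_f f (\<Union>\<A>) A)"
      by (rule MA_omega1_uncountable_members[OF assms system(1)[OF sys] _ system(3)[OF sys]])
  qed
qed

end
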